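(* Let $n>1$ be an integer and let $m_1,m_2,\ldots,m_{n-1}$ be integers such that $$\big|\{1\le s<n:\ d\nmid m_s\}\big|\ \ge\ d-1\quad\text{for every positive divisor } d \text{ of } n.$$ Then the set $$\Big\{\sum_{i\in I}m_i:\ I\subseteq\{1,\ldots,n-1\}\Big\}$$ contains a complete system of residues modulo $n$.
   Context: The empty subset $I$ gives the sum $0$. *)

theory Defs
  imports "HOL-Number_Theory.Number_Theory"
begin

definition complete_residue_system :: "nat \<Rightarrow> int set \<Rightarrow> bool" where
  "complete_residue_system n R \<longleftrightarrow> (\<forall>a::int. \<exists>!r. r \<in> R \<and> [a = r] (mod int n))"

end

theory Submission
  imports Defs
begin

text \<open>
  Choose an index set \<open>T\<close>, as large as possible, whose subset sums occupy at least \<open>|T| + 1\<close>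
  residues modulo \<open>n\<close>. By maximality, each \<open>m\<^sub>s\<close> with \<open>s\<close> outside \<open>T\<close> is a period of the set \<open>S\<close>
  of these residues. Let \<open>d\<close>, a divisor of \<open>n\<close>, generate the periods of \<open>S\<close>. If \<open>d = n\<close>, then \<open>T\<close>
  contains all \<open>s\<close> with \<open>n\<close> not dividing \<open>m\<^sub>s\<close>, so \<open>|T| \<ge> n - 1\<close> and \<open>S\<close> is everything. If \<open>d < n\<close>,
  then by induction the subset sums represent all residues modulo \<open>d\<close>, and only indices in \<open>T\<close>
  matter modulo \<open>d\<close>; as \<open>S\<close> has period \<open>d\<close>, it is again everything.
\<close>

definition sum_residues :: "nat \<Rightarrow> ('a \<Rightarrow> int) \<Rightarrow> 'a set \<Rightarrow> int set" where
  "sum_residues n m T = (\<lambda>I. (\<Sum>i\<in>I. m i) mod int n) ` Pow T"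

lemma finite_sum_residues: "finite T \<Longrightarrow> finite (sum_residues n m T)"
  by (simp add: sum_residues_def)

lemma sum_residues_subset: "n > 0 \<Longrightarrow> sum_residues n m T \<subseteq> {0..<int n}"
  by (auto simp: sum_residues_def)

lemma sum_residues_mono: "T \<subseteq> U \<Longrightarrow> sum_residues n m T \<subseteq> sum_residues n m U"
  by (auto simp: sum_residues_def)

lemma sum_residues_shift:
  assumes "finite T" "a \<notin> T" "x mod int n \<in> sum_residues n m T"
  shows "(x + m a) mod int n \<in> sum_residues n m (insert a T)"
proof -
  obtain I where I: "I \<subseteq> T" "x mod int n = (\<Sum>i\<in>I. m i) mod int n"
    using assms(3) by (auto simp: sum_residues_def)
  have "finite I" "a \<notin> I"
    using I(1) assms finite_subset by auto
  then have "(\<Sum>i\<in>insert a I. m i) = (\<Sum>i\<in>I. m i) + m a"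
    by simp
  then have "(x + m a) mod int n = (\<Sum>i\<in>insert a I. m i) mod int n"
    using I(2) by (metis mod_add_left_eq)
  moreover have "insert a I \<subseteq> insert a T"
    using I(1) by auto
  ultimately show ?thesis
    unfolding sum_residues_def by blast
qed

text \<open>The empty set satisfies the cardinality bound, its only residue being that of the empty
  sum, so a \<open>T\<close> of largest size exists. Enlarging it by \<open>a\<close> then yields no
  new residue, while the shift by \<open>m a\<close> lands among the residues for
  \<open>insert a T\<close>.\<close>

lemma maximal_sum_residues:
  assumes "finite F"
  obtains T where "T \<subseteq> F" "card T + 1 \<le> card (sum_residues n m T)"
    "\<And>a x. a \<in> F - T \<Longrightarrow> x mod int n \<in> sum_residues n m T
      \<Longrightarrow> (x + m a) mod int n \<in> sum_residues n m T"
proof -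
  let ?P = "\<lambda>T. T \<subseteq> F \<and> card T + 1 \<le> card (sum_residues n m T)"
  have "?P {}"
    by (simp add: sum_residues_def)
  moreover have "\<forall>T. ?P T \<longrightarrow> card T < Suc (card F)"
    using assms by (auto simp: less_Suc_eq_le intro: card_mono)
  ultimately obtain T where T: "?P T" and max: "\<And>U. ?P U \<Longrightarrow> card U \<le> card T"
    using ex_has_greatest_nat[of ?P "{}" card "Suc (card F)"] by blast
  have fin: "finite T"
    using T assms finite_subset by blast
  have "(x + m a) mod int n \<in> sum_residues n m T"
    if a: "a \<in> F - T" and x: "x mod int n \<in> sum_residues n m T" for a x
  proof -
    have "\<not> ?P (insert a T)"
      using max[of "insert a T"] a fin by auto
    \<comment> \<open>Failure of the bound for \<open>insert a T\<close> leaves at most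
      \<open>card T + 1\<close> residues there, and \<open>T\<close> already has that many.\<close>
    then have "card (sum_residues n m (insert a T)) \<le> card (sum_residues n m T)"
      using T a fin by auto
    then have "sum_residues n m T = sum_residues n m (insert a T)"
      using fin by (intro card_seteq finite_sum_residues sum_residues_mono) auto
    then show ?thesis
      using sum_residues_shift[of T a x n m] a x fin by auto
  qed
  with T that show thesis by blast
qed

text \<open>Since \<open>S\<close> is invariant under \<open>n\<close>, closure under a one-sided
  shift by \<open>h\<close> implies closure under all integer multiples of \<open>h\<close>. Hence
  the shifts preserving \<open>S\<close> form a subgroup of the integers, generated by its least
  positive element \<open>d\<close>.\<close>

lemma least_period:
  fixes S :: "int set"
  assumes "n > 0" and n: "\<And>x. x \<in> S \<longleftrightarrow> x + int n \<in> S"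
  obtains d where "0 < d" "\<And>x k. x \<in> S \<longleftrightarrow> x + k * int d \<in> S"
    "\<And>h. (\<And>x. x \<in> S \<Longrightarrow> x + h \<in> S) \<Longrightarrow> int d dvd h"
proof -
  have iter: "x + int k * h \<in> S" if "\<And>x. x \<in> S \<Longrightarrow> x + h \<in> S" "x \<in> S" for h x k
  proof (induction k)
    case (Suc k)
    then show ?case using that(1)[OF Suc] by (simp add: algebra_simps)
  qed (use that in simp)
  have mult_n: "x + k * int n \<in> S" if "x \<in> S" for x k
  proof -
    have "x + int j * int n \<in> S" "x + int j * (- int n) \<in> S" for j
      using iter[of "int n" x j] iter[of "- int n" x j] that n n[of "_ - int n"] by auto
    then show ?thesis
      by (cases k rule: int_cases2) auto
  qed
  \<comment> \<open>\<open>S\<close> is periodic modulo \<open>n\<close>, so a negative multiplier may be replaced by a natural one.\<close>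
  have mult: "x + k * h \<in> S" if "\<And>x. x \<in> S \<Longrightarrow> x + h \<in> S" "x \<in> S" for h x k
  proof -
    obtain j where j: "k mod int n = int j"
      using assms(1) by (metis of_nat_0_less_iff pos_mod_sign nonneg_int_cases)
    have "k = int j + k div int n * int n"
      unfolding j[symmetric] by simp
    then have "x + k * h = x + int j * h + (k div int n * h) * int n"
      by (metis add.assoc distrib_right mult.assoc mult.commute)
    then show ?thesis
      using mult_n iter that by metis
  qed
  define P where "P d \<longleftrightarrow> d > 0 \<and> (\<forall>x\<in>S. x + int d \<in> S)" for d
  define d where "d = (LEAST d. P d)"
  have "P n"
    using assms unfolding P_def by blast
  then have "P d"
    unfolding d_def by (rule LeastI)
  then have "d > 0" and d: "\<And>x. x \<in> S \<Longrightarrow> x + int d \<in> S"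
    unfolding P_def by auto
  have "int d dvd h" if h: "\<And>x. x \<in> S \<Longrightarrow> x + h \<in> S" for h
  proof -
    \<comment> \<open>Division with remainder: the remainder of \<open>h\<close> is again a period
      and is smaller than \<open>d\<close>, so minimality forces it to be 0.\<close>
    have "x + h mod int d \<in> S" if "x \<in> S" for x
    proof -
      have "x + h + (- (h div int d)) * int d \<in> S"
        by (intro mult d h that)
      then show ?thesis
        by (simp add: minus_div_mult_eq_mod [symmetric] algebra_simps)
    qed
    moreover have "nat (h mod int d) < d"
      using \<open>d > 0\<close> by (simp add: nat_less_iff)
    then have "\<not> P (nat (h mod int d))"
      unfolding d_def by (rule not_less_Least)
    ultimately have "\<not> h mod int d > 0"
      by (auto simp: P_def)
    moreover have "h mod int d \<ge> 0"
      using \<open>d > 0\<close> by simp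
    ultimately show ?thesis
      by (simp add: dvd_eq_mod_eq_0)
  qed
  moreover have "x \<in> S \<longleftrightarrow> x + k * int d \<in> S" for x k
    using mult[of "int d" x k] mult[of "int d" "x + k * int d" "-k"] d by auto
  ultimately show thesis
    using that \<open>d > 0\<close> by blast
qed

text \<open>The index set \<open>F\<close> is kept independent of \<open>n\<close>, because the
  induction replaces \<open>n\<close> by a proper divisor \<open>d\<close> and retains all of
  \<open>F\<close>.\<close>

lemma sum_residues_eq_all:
  assumes "finite F" "n > 0"
    and "\<And>d. d > 0 \<Longrightarrow> d dvd n \<Longrightarrow> d - 1 \<le> card {s \<in> F. \<not> int d dvd m s}"
  shows "sum_residues n m F = {0..<int n}"
  using assms(2,3)
proof (induction n rule: less_induct)
  case (less n)
  obtain T where T: "T \<subseteq> F" "card T + 1 \<le> card (sum_residues n m T)"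
    and closed: "\<And>a x. a \<in> F - T \<Longrightarrow> x mod int n \<in> sum_residues n m T
      \<Longrightarrow> (x + m a) mod int n \<in> sum_residues n m T"
    using maximal_sum_residues[OF assms(1)] by metis
  \<comment> \<open>Passing to the full preimage in the integers turns periods modulo
    \<open>n\<close> into ordinary translations.\<close>
  define S where "S = {x. x mod int n \<in> sum_residues n m T}"
  have "x \<in> S \<longleftrightarrow> x + int n \<in> S" for x
    by (simp add: S_def)
  with \<open>n > 0\<close> obtain d where "d > 0" and d: "\<And>x k. x \<in> S \<longleftrightarrow> x + k * int d \<in> S"
    and gen: "\<And>h. (\<And>x. x \<in> S \<Longrightarrow> x + h \<in> S) \<Longrightarrow> int d dvd h"
    using least_period[of n S] by metis
  have "int d dvd int n"
    by (rule gen) (simp add: S_def)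
  then have "d dvd n" by simp
  have outside: "int d dvd m a" if "a \<in> F - T" for a
    by (rule gen) (use closed that in \<open>auto simp: S_def\<close>)
  have "{0..<int n} \<subseteq> sum_residues n m T"
  proof (cases "d = n")
    case True
    have "{s \<in> F. \<not> int n dvd m s} \<subseteq> T"
      using outside True by auto
    then have "n - 1 \<le> card T"
      using less.prems(2)[of n] \<open>n > 0\<close> T(1) assms(1)
      by (meson card_mono dvd_refl finite_subset order_trans)
    then have "sum_residues n m T = {0..<int n}"
      using T(2) sum_residues_subset \<open>n > 0\<close> by (intro card_seteq) auto
    then show ?thesis by simp
  next
    case False
    then have "d < n"
      using \<open>d dvd n\<close> \<open>n > 0\<close> by (simp add: dvd_imp_le le_neq_implies_less)
    \<comment> \<open>Every divisor of \<open>d\<close> divides \<open>n\<close>, so the counting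
      hypothesis is inherited.\<close>
    then have IH: "sum_residues d m F = {0..<int d}"
      using \<open>d > 0\<close> \<open>d dvd n\<close> less.prems(2) by (intro less.IH) (auto intro: dvd_trans)
    show ?thesis
    proof
      fix a assume a: "a \<in> {0..<int n}"
      have "a mod int d \<in> sum_residues d m F"
        using IH \<open>d > 0\<close> by simp
      then obtain I where I: "I \<subseteq> F" "a mod int d = (\<Sum>i\<in>I. m i) mod int d"
        by (auto simp: sum_residues_def)
      have "finite I"
        using I(1) assms(1) finite_subset by blast
      \<comment> \<open>Dropping the indices outside \<open>T\<close> changes the sum by a multiple
        of \<open>d\<close>, which is a period of \<open>S\<close>.\<close>
      then have "(\<Sum>i\<in>I. m i) = (\<Sum>i\<in>I \<inter> T. m i) + (\<Sum>i\<in>I - T. m i)"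
        by (rule sum.Int_Diff)
      moreover have "int d dvd (\<Sum>i\<in>I - T. m i)"
        using outside I(1) by (intro dvd_sum) auto
      ultimately have "int d dvd a - (\<Sum>i\<in>I \<inter> T. m i)"
        using I(2) by (metis add_diff_cancel_left' diff_add_eq diff_diff_eq2 dvd_add mod_eq_dvd_iff)
      then obtain k where "a - (\<Sum>i\<in>I \<inter> T. m i) = k * int d"
        by (metis dvdE mult.commute)
      then have "a = (\<Sum>i\<in>I \<inter> T. m i) + k * int d"
        by simp
      moreover have "(\<Sum>i\<in>I \<inter> T. m i) \<in> S"
        by (auto simp: S_def sum_residues_def)
      ultimately have "a \<in> S"
        using d by simp
      then show "a \<in> sum_residues n m T"
        using a by (simp add: S_def)
    qed
  qed
  then show ?case
    using sum_residues_mono[OF T(1), of n m] sum_residues_subset[OF \<open>n > 0\<close>, of m F] by auto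
qed

text \<open>Choosing one preimage in \<open>X\<close> for each residue makes reduction modulo
  \<open>n\<close> injective on \<open>R\<close>, which gives uniqueness of representatives.\<close>

lemma complete_residue_subsystem:
  assumes "n > 0" "{0..<int n} \<subseteq> (\<lambda>x. x mod int n) ` X"
  shows "\<exists>R\<subseteq>X. complete_residue_system n R"
proof -
  obtain R where R: "R \<subseteq> X" "inj_on (\<lambda>x. x mod int n) R" "{0..<int n} = (\<lambda>x. x mod int n) ` R"
    using assms(2) by (auto simp: subset_image_inj)
  have "\<exists>!r. r \<in> R \<and> [a = r] (mod int n)" for a
  proof -
    have "a mod int n \<in> (\<lambda>x. x mod int n) ` R"
      using R(3) assms(1) by auto
    then show ?thesis
      using R(2) by (auto simp: cong_def inj_on_def)
  qed
  then show ?thesis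
    using R(1) unfolding complete_residue_system_def by blast
qed

theorem theorem1p2:
  fixes n :: nat and m :: "nat \<Rightarrow> int"
  assumes "n > 1"
    and "\<And>d::nat. d > 0 \<Longrightarrow> d dvd n \<Longrightarrow> card {s. 1 \<le> s \<and> s < n \<and> \<not> int d dvd m s} \<ge> d - 1"
  shows "\<exists>R. R \<subseteq> {\<Sum>i\<in>I. m i | I. I \<subseteq> {1..n-1}} \<and> complete_residue_system n R"
proof -
  have "{s \<in> {1..n-1}. \<not> int d dvd m s} = {s. 1 \<le> s \<and> s < n \<and> \<not> int d dvd m s}" for d
    using assms(1) by auto
  then have "sum_residues n m {1..n-1} = {0..<int n}"
    using assms by (intro sum_residues_eq_all) auto
  moreover have "sum_residues n m {1..n-1}
      = (\<lambda>x. x mod int n) ` {\<Sum>i\<in>I. m i | I. I \<subseteq> {1..n-1}}"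
    by (auto simp: sum_residues_def)
  ultimately show ?thesis
    using complete_residue_subsystem assms(1) by simp
qed

end
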